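(* There is a positive constant $c$ such that for all integers $n,k$ with $n\ge k\ge 2$, \[ \frac{n(n-1)}{k(k-1)}\;\le\;\overline{m}(n,k)\;\le\; c\cdot\frac{n(n-1)}{k(k-1)} . \]
   Context: A hypergraph is an ordered pair $(X,H)$ such that $X$ is a set (of vertices) and $H$ is a family of subsets of $X$ (edges, which may have arbitrary sizes). A set $T$ of vertices in a hypergraph is called affinely closed if, and only if, every edge that shares at least two vertices with $T$ is fully contained in $T$. For every set $S$ of vertices, the affine closure $\mathrm{aff}(S)$ is the intersection of all affinely closed supersets of $S$ (it is itself affinely closed). The closure-lines in the hypergraph are all the sets $\mathrm{aff}(\{u,v\})$ with $u$ and $v$ two distinct vertices. For integers $n,k$, $\overline{m}(n,k)$ denotes the smallest number of (distinct) closure-lines in a hypergraph on $n$ vertices where every closure-line consists of at most $k$ vertices. *)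

theory Defs
  imports Complex_Main
begin

definition hypergraph :: "'a set \<Rightarrow> 'a set set \<Rightarrow> bool" where
  "hypergraph X H \<longleftrightarrow> H \<subseteq> Pow X"

definition affinely_closed :: "'a set \<Rightarrow> 'a set set \<Rightarrow> 'a set \<Rightarrow> bool" where
  "affinely_closed X H T \<longleftrightarrow>
     T \<subseteq> X \<and> (\<forall>E\<in>H. (\<exists>u v. u \<noteq> v \<and> {u, v} \<subseteq> E \<inter> T) \<longrightarrow> E \<subseteq> T)"

definition aff :: "'a set \<Rightarrow> 'a set set \<Rightarrow> 'a set \<Rightarrow> 'a set" where
  "aff X H S = \<Inter> {T. affinely_closed X H T \<and> S \<subseteq> T}"

definition closure_lines :: "'a set \<Rightarrow> 'a set set \<Rightarrow> 'a set set" where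
  "closure_lines X H = {aff X H {u, v} | u v. u \<in> X \<and> v \<in> X \<and> u \<noteq> v}"

(* Every finite hypergraph is isomorphic to one whose vertices are natural numbers, so nat serves
   as the vertex type. The lemmas m_bar_attained and m_bar_le below show that for k \<ge> 2
   the minimum is attained and is a lower bound for hypergraphs over every vertex type. *)
definition m_bar :: "nat \<Rightarrow> nat \<Rightarrow> nat" where
  "m_bar n k = (LEAST m. \<exists>(X :: nat set) H.
     finite X \<and> card X = n \<and> hypergraph X H \<and>
     (\<forall>L \<in> closure_lines X H. card L \<le> k) \<and> m = card (closure_lines X H))"

lemma inj_on_image_subset:
  assumes "inj_on f X" "A \<subseteq> X" "B \<subseteq> X"
  shows "f ` A \<subseteq> f ` B \<longleftrightarrow> A \<subseteq> B"
proof
  assume sub: "f ` A \<subseteq> f ` B"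
  show "A \<subseteq> B"
  proof
    fix x assume "x \<in> A"
    then have "f x \<in> f ` B" "x \<in> X"
      using sub assms(2) by auto
    then show "x \<in> B"
      using inj_on_image_mem_iff[OF assms(1) _ assms(3)] by simp
  qed
qed (rule image_mono)

lemma affinely_closed_image:
  assumes inj: "inj_on f X" and H: "H \<subseteq> Pow X" and T: "T \<subseteq> X"
  shows "affinely_closed (f ` X) ((`) f ` H) (f ` T) \<longleftrightarrow> affinely_closed X H T"
proof -
  have sub: "f ` E \<subseteq> f ` T \<longleftrightarrow> E \<subseteq> T" if "E \<in> H" for E
    using inj_on_image_subset[OF inj _ T] that H by blast
  have two: "(\<exists>u v. u \<noteq> v \<and> {u, v} \<subseteq> f ` E \<inter> f ` T) \<longleftrightarrow>
      (\<exists>u v. u \<noteq> v \<and> {u, v} \<subseteq> E \<inter> T)" if "E \<in> H" for E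
  proof -
    have "f ` E \<inter> f ` T = f ` (E \<inter> T)"
      using inj_on_image_Int[OF inj, of E T] that H T by blast
    moreover have injET: "inj_on f (E \<inter> T)"
      by (rule inj_on_subset[OF inj]) (use T in auto)
    moreover have "(\<exists>u v. u \<noteq> v \<and> {u, v} \<subseteq> f ` (E \<inter> T)) \<longleftrightarrow>
        (\<exists>u v. u \<noteq> v \<and> {u, v} \<subseteq> E \<inter> T)" (is "?L \<longleftrightarrow> ?R")
    proof
      assume ?L
      then obtain u v where "u \<in> E \<inter> T" "v \<in> E \<inter> T" "f u \<noteq> f v"
        by auto
      then have "u \<noteq> v" "{u, v} \<subseteq> E \<inter> T"
        by auto
      then show ?R by blast
    next
      assume ?R
      then obtain u v where "u \<noteq> v" "u \<in> E \<inter> T" "v \<in> E \<inter> T"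
        by blast
      then have "f u \<noteq> f v" "{f u, f v} \<subseteq> f ` (E \<inter> T)"
        using injET by (auto simp: inj_on_def)
      then show ?L by blast
    qed
    ultimately show ?thesis
      by simp
  qed
  show ?thesis
    using T unfolding affinely_closed_def
    by (simp only: ball_simps(9) sub two image_mono cong: ball_cong)
qed

lemma aff_image:
  assumes inj: "inj_on f X" and H: "H \<subseteq> Pow X" and S: "S \<subseteq> X"
  shows "aff (f ` X) ((`) f ` H) (f ` S) = f ` aff X H S"
proof -
  let ?C = "{T. affinely_closed X H T \<and> S \<subseteq> T}"
  have C: "T \<subseteq> X" if "T \<in> ?C" for T
    using that by (auto simp: affinely_closed_def)
  have "X \<in> ?C"
    using H S by (auto simp: affinely_closed_def)
  have "{T. affinely_closed (f ` X) ((`) f ` H) T \<and> f ` S \<subseteq> T} = (`) f ` ?C" (is "?D = _")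
  proof (rule set_eqI)
    fix T'
    show "T' \<in> ?D \<longleftrightarrow> T' \<in> (`) f ` ?C"
    proof
      assume T': "T' \<in> ?D"
      then obtain T where T: "T \<subseteq> X" "T' = f ` T"
        by (auto simp: affinely_closed_def subset_image_iff)
      moreover have "S \<subseteq> T"
        using T' T(2) inj_on_image_subset[OF inj S T(1)] by blast
      ultimately have "T \<in> ?C"
        using T' affinely_closed_image[OF inj H T(1)] by auto
      then show "T' \<in> (`) f ` ?C"
        using T by blast
    next
      assume "T' \<in> (`) f ` ?C"
      then obtain T where T: "T \<in> ?C" "T' = f ` T"
        by blast
      then show "T' \<in> ?D"
        using affinely_closed_image[OF inj H C[OF T(1)]] by auto
    qed
  qed
  moreover have "f ` (\<Inter>T\<in>?C. T) = (\<Inter>T\<in>?C. f ` T)"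
    by (rule image_INT[OF inj _ \<open>X \<in> ?C\<close>]) (use C in blast)
  ultimately show ?thesis
    by (simp add: aff_def)
qed

lemma closure_lines_image:
  assumes inj: "inj_on f X" and H: "H \<subseteq> Pow X"
  shows "closure_lines (f ` X) ((`) f ` H) = (`) f ` closure_lines X H"
proof -
  have "aff (f ` X) ((`) f ` H) {f u, f v} = f ` aff X H {u, v}" if "u \<in> X" "v \<in> X" for u v
    using aff_image[OF inj H, of "{u, v}"] that by simp
  note aff = this
  show ?thesis
  proof (intro set_eqI iffI)
    fix L assume "L \<in> closure_lines (f ` X) ((`) f ` H)"
    then obtain u v where "u \<in> X" "v \<in> X" "u \<noteq> v" "L = f ` aff X H {u, v}"
      using aff unfolding closure_lines_def by blast
    then show "L \<in> (`) f ` closure_lines X H"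
      unfolding closure_lines_def by blast
  next
    fix L assume "L \<in> (`) f ` closure_lines X H"
    then obtain u v where uv: "u \<in> X" "v \<in> X" "u \<noteq> v" "L = f ` aff X H {u, v}"
      unfolding closure_lines_def by blast
    then have "f u \<noteq> f v" "L = aff (f ` X) ((`) f ` H) {f u, f v}"
      using aff inj by (auto simp: inj_on_def)
    then show "L \<in> closure_lines (f ` X) ((`) f ` H)"
      using uv unfolding closure_lines_def by blast
  qed
qed

lemma closure_lines_subset:
  assumes "hypergraph X H" "L \<in> closure_lines X H"
  shows "L \<subseteq> X"
proof -
  have "affinely_closed X H X"
    using assms(1) by (auto simp: affinely_closed_def hypergraph_def)
  moreover obtain u v where "L = aff X H {u, v}" "u \<in> X" "v \<in> X"
    using assms(2) unfolding closure_lines_def by blast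
  ultimately show ?thesis
    unfolding aff_def by blast
qed

lemma m_bar_attained:
  assumes "k \<ge> 2"
  shows "\<exists>(X :: nat set) H. finite X \<and> card X = n \<and> hypergraph X H \<and>
     (\<forall>L \<in> closure_lines X H. card L \<le> k) \<and> m_bar n k = card (closure_lines X H)"
proof -
  have "card L \<le> k" if L: "L \<in> closure_lines {..<n} {}" for L
  proof -
    obtain u v where uv: "L = aff {..<n} {} {u, v}" "u < n" "v < n"
      using L by (auto simp: closure_lines_def)
    have "affinely_closed {..<n} {} {u, v}"
      using uv by (simp add: affinely_closed_def)
    then have "L \<subseteq> {u, v}"
      unfolding uv(1) aff_def by blast
    then have "card L \<le> card {u, v}"
      by (intro card_mono) auto
    also have "\<dots> \<le> 2"
      by (simp add: card_insert_if)
    finally show ?thesis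
      using assms by simp
  qed
  then have "\<exists>m (X :: nat set) H. finite X \<and> card X = n \<and> hypergraph X H \<and>
     (\<forall>L \<in> closure_lines X H. card L \<le> k) \<and> m = card (closure_lines X H)"
    by (intro exI[of _ "card (closure_lines {..<n} {})"] exI[of _ "{..<n}"] exI[of _ "{}"])
       (auto simp: hypergraph_def)
  from LeastI_ex[OF this] show ?thesis
    unfolding m_bar_def .
qed

lemma m_bar_le:
  fixes X :: "'a set"
  assumes "finite X" "card X = n" "hypergraph X H" "\<forall>L \<in> closure_lines X H. card L \<le> k"
  shows "m_bar n k \<le> card (closure_lines X H)"
proof -
  obtain f :: "'a \<Rightarrow> nat" where f: "bij_betw f X {0..<card X}"
    using assms(1) ex_bij_betw_finite_nat by blast
  then have inj: "inj_on f X"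
    by (simp add: bij_betw_def)
  have H: "H \<subseteq> Pow X"
    using assms(3) by (simp add: hypergraph_def)
  have lines: "closure_lines (f ` X) ((`) f ` H) = (`) f ` closure_lines X H"
    by (rule closure_lines_image[OF inj H])
  have sub: "L \<subseteq> X" if "L \<in> closure_lines X H" for L
    using closure_lines_subset[OF assms(3) that] .
  have "inj_on ((`) f) (closure_lines X H)"
    by (rule inj_on_subset[OF inj_on_image_Pow[OF inj]]) (use sub in blast)
  then have cl: "card (closure_lines (f ` X) ((`) f ` H)) = card (closure_lines X H)"
    unfolding lines by (rule card_image)
  have "\<forall>L \<in> closure_lines (f ` X) ((`) f ` H). card L \<le> k"
    unfolding lines using assms(4) sub inj by (auto simp: card_image inj_on_subset)
  moreover have "hypergraph (f ` X) ((`) f ` H)"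
    using H by (auto simp: hypergraph_def)
  moreover have "card (f ` X) = n"
    using assms(2) card_image[OF inj] by simp
  ultimately show ?thesis
    unfolding m_bar_def using assms(1) cl
    by (intro Least_le exI[of _ "f ` X"] exI[of _ "(`) f ` H"]) auto
qed

end

(* Lower bound: a closure-line covers at most k(k - 1) of the n(n - 1) ordered pairs of vertices.

   Upper bound: let q be a power of 2 of order n / k. If 16 n <= k^2, replace every point of the
   affine plane of order q by a cell of about n / q^2 vertices; taking as edges the cells and the
   triples of vertices from three different collinear cells, the closure-lines are the cells and
   the unions of the cells along a line, O(q^2) in total. If 16 n > k^2, split the vertices into
   about k / 4 groups of size at most q, join vertices of different groups by the q^2 blocks of a
   transversal design over the field of order q, and recurse inside the groups. For bounded k the
   hypergraph without edges suffices.

   The field of order q = 2^m is found inside the algebraic closure of the field with two elements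
   as the set of roots of x^q - x. *)
theory Submission
  imports Defs "HOL-Algebra.Algebraic_Closure_Type" "HOL-Library.Z2"
begin

section \<open>Finite fields of order 2^m\<close>

text \<open>The polynomial x^q - x splits over an algebraically closed field and has only simple
  roots, so it has exactly q of them. In characteristic 2 the map x -> x^q is additive as well as
  multiplicative, so the roots are closed under the field operations. Division by 0 is harmless,
  since x / 0 = 0 is itself a root.\<close>

lemma finite_subfield_char_2:
  fixes m :: nat
  assumes two: "(2 :: 'a :: alg_closed_field) = 0" and m: "m > 0"
  obtains F :: "'a :: alg_closed_field set" where "card F = 2 ^ m"
    "\<And>x y. x \<in> F \<Longrightarrow> y \<in> F \<Longrightarrow> x + y \<in> F \<and> x - y \<in> F \<and> x * y \<in> F \<and> x / y \<in> F"
proof -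
  define q :: nat where "q = 2 ^ m"
  have q: "q > 1"
    using m one_less_power[of "2::nat" m] by (simp add: q_def)
  define F where "F = {x :: 'a. x ^ q = x}"
  define f :: "'a poly" where "f = monom 1 q - monom 1 1"
  have "degree f = q" "lead_coeff f = 1"
  proof -
    have deg: "degree (monom (1::'a) 1) < degree (monom (1::'a) q)"
      using q by (simp add: degree_monom_eq)
    show "degree f = q"
      unfolding f_def diff_conv_add_uminus
      by (subst degree_add_eq_left) (use deg in \<open>simp_all add: degree_monom_eq\<close>)
    then show "lead_coeff f = 1"
      using q by (simp add: f_def)
  qed
  moreover from this have "f \<noteq> 0"
    by auto
  ultimately obtain A where A: "size A = q" "f = (\<Prod>x\<in>#A. [:- x, 1:])"
    using alg_closed_imp_factorization[of f] by auto
  have poly_f: "poly f x = x ^ q - x" for x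
    by (simp add: f_def poly_monom)
  have "x \<in># A \<longleftrightarrow> poly f x = 0" for x
    by (auto simp: A(2) poly_prod_mset prod_mset_zero_iff)
  then have "set_mset A = F"
    by (auto simp: F_def poly_f)
  moreover have "count A a \<le> 1" for a
  proof (rule ccontr)
    assume "\<not> count A a \<le> 1"
    then have "replicate_mset 2 a \<subseteq># A"
      by (simp flip: count_le_replicate_mset_subset_eq)
    then obtain B where "A = replicate_mset 2 a + B"
      using subset_mset.le_iff_add by blast
    then have "f = [:- a, 1:] * ([:- a, 1:] * (\<Prod>x\<in>#B. [:- x, 1:]))"
      unfolding A(2) by (simp add: numeral_2_eq_2)
    then have "poly (pderiv f) a = 0"
      by (simp only: pderiv_mult) simp
    \<comment> \<open>As q is even, the derivative q x^(q-1) - 1 is the constant -1 and has no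
      root.\<close>
    moreover have "of_nat q = (0 :: 'a)"
      using m by (simp add: q_def two)
    ultimately show False
      by (simp add: f_def pderiv_diff pderiv_monom poly_monom)
  qed
  ultimately have "card F = 2 ^ m"
    using A(1) by (metis mset_set_set_mset_msubset q_def size_mset_set count_mset_set(1) finite_set_mset
        multiset_eqI count_greater_eq_one_iff le_antisym not_in_iff count_mset_set(3))
  moreover have add: "(x + y) ^ q = x ^ q + y ^ q" for x y :: 'a
    unfolding q_def
  proof (induction m)
    case (Suc m)
    \<comment> \<open>Squaring is additive in characteristic 2, and x -> x^q is squaring iterated m
      times.\<close>
    have "(a + b)\<^sup>2 = a\<^sup>2 + b\<^sup>2" for a b :: 'a
      by (simp add: power2_sum two)
    then show ?case
      by (simp add: Suc mult.commute[of 2] power_mult)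
  qed simp
  have sub: "x - y = x + y" for x y :: 'a
    using two by (metis add_diff_cancel_left' add_diff_eq diff_add_cancel mult_2 mult_zero_left)
  have "x + y \<in> F \<and> x - y \<in> F \<and> x * y \<in> F \<and> x / y \<in> F" if "x \<in> F" "y \<in> F" for x y
    using that by (simp add: F_def add sub power_mult_distrib power_divide)
  ultimately show ?thesis
    using that by blast
qed

text \<open>For every m the field is a set inside one fixed type, so that m can vary freely within a
  proof. Characteristic 2 is inherited from \<open>bit\<close> through the embedding
  \<open>to_ac\<close>.\<close>

lemma finite_field_of_order_power_2:
  assumes "m > 0"
  obtains F :: "bit alg_closure set" where "card F = 2 ^ m"
    "\<And>x y. x \<in> F \<Longrightarrow> y \<in> F \<Longrightarrow> x + y \<in> F \<and> x - y \<in> F \<and> x * y \<in> F \<and> x / y \<in> F"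
proof -
  have "(2 :: bit alg_closure) = to_ac 2"
    by (simp only: to_ac_numeral)
  then have "(2 :: bit alg_closure) = 0"
    by simp
  from finite_subfield_char_2[OF this assms] that show ?thesis
    by blast
qed

section \<open>Recognising closure-lines, and optimal hypergraphs on a prescribed vertex set\<close>

text \<open>A closed set through u and v that is contained in every such set is the affine closure
  of {u, v}. Closure-lines can thus be identified without computing any intersection.\<close>

lemma closure_lines_subset_family:
  assumes "\<And>u v. u \<in> W \<Longrightarrow> v \<in> W \<Longrightarrow> u \<noteq> v \<Longrightarrow>
    \<exists>L\<in>\<L>. affinely_closed W H L \<and> u \<in> L \<and> v \<in> L \<and>
      (\<forall>T. affinely_closed W H T \<longrightarrow> u \<in> T \<longrightarrow> v \<in> T \<longrightarrow> L \<subseteq> T)"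
  shows "closure_lines W H \<subseteq> \<L>"
proof
  fix K assume "K \<in> closure_lines W H"
  then obtain u v where K: "K = aff W H {u, v}" and "u \<in> W" "v \<in> W" "u \<noteq> v"
    unfolding closure_lines_def by blast
  then obtain L where L: "L \<in> \<L>" "affinely_closed W H L" "u \<in> L" "v \<in> L"
    "\<And>T. affinely_closed W H T \<Longrightarrow> u \<in> T \<Longrightarrow> v \<in> T \<Longrightarrow> L \<subseteq> T"
    using assms[of u v] by blast
  then have "K = L"
    unfolding K aff_def by blast
  with L show "K \<in> \<L>" by simp
qed

lemma m_bar_le_family:
  assumes "finite W" "hypergraph W H" "finite \<L>" "\<And>L. L \<in> \<L> \<Longrightarrow> card L \<le> k"
    and "\<And>u v. u \<in> W \<Longrightarrow> v \<in> W \<Longrightarrow> u \<noteq> v \<Longrightarrow>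
    \<exists>L\<in>\<L>. affinely_closed W H L \<and> u \<in> L \<and> v \<in> L \<and>
      (\<forall>T. affinely_closed W H T \<longrightarrow> u \<in> T \<longrightarrow> v \<in> T \<longrightarrow> L \<subseteq> T)"
  shows "m_bar (card W) k \<le> card \<L>"
proof -
  have sub: "closure_lines W H \<subseteq> \<L>"
    using assms(5) by (rule closure_lines_subset_family)
  then have "m_bar (card W) k \<le> card (closure_lines W H)"
    using assms by (intro m_bar_le) auto
  also have "\<dots> \<le> card \<L>"
    using sub assms(3) by (rule card_mono[rotated])
  finally show ?thesis .
qed

lemma affinely_closedI:
  assumes "T \<subseteq> W"
    "\<And>E x y. E \<in> H \<Longrightarrow> x \<noteq> y \<Longrightarrow> x \<in> E \<Longrightarrow> y \<in> E \<Longrightarrow> x \<in> T \<Longrightarrow> y \<in> T \<Longrightarrow> E \<subseteq> T"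
  shows "affinely_closed W H T"
  using assms unfolding affinely_closed_def by blast

lemma affinely_closedD:
  assumes "affinely_closed W H T" "E \<in> H" "x \<noteq> y" "x \<in> E" "y \<in> E" "x \<in> T" "y \<in> T"
  shows "E \<subseteq> T"
  using assms unfolding affinely_closed_def by blast

text \<open>Closedness passes to intersections; \<open>S \<subseteq> W\<close> makes
  \<open>W\<close> one of the sets intersected, which keeps the closure inside
  \<open>W\<close>.\<close>

lemma affinely_closed_aff:
  assumes "hypergraph W H" "S \<subseteq> W"
  shows "affinely_closed W H (aff W H S)"
proof (rule affinely_closedI)
  have "affinely_closed W H W"
    using assms(1) by (auto simp: affinely_closed_def hypergraph_def)
  then show "aff W H S \<subseteq> W"
    using assms(2) unfolding aff_def by blast
next
  fix E x y
  assume "E \<in> H" "x \<noteq> y" "x \<in> E" "y \<in> E" "x \<in> aff W H S" "y \<in> aff W H S"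
  then show "E \<subseteq> aff W H S"
    unfolding aff_def using affinely_closedD[of W H _ E x y] by fastforce
qed

text \<open>An optimal hypergraph on natural numbers is carried along a bijection to the given
  vertex set. The recursion uses this to place optimal hypergraphs inside the groups.\<close>

lemma m_bar_attained_on:
  assumes "finite (W :: 'a set)" "k \<ge> 2"
  obtains H where "hypergraph W H" "\<And>L. L \<in> closure_lines W H \<Longrightarrow> card L \<le> k"
    "card (closure_lines W H) = m_bar (card W) k"
proof -
  obtain Y :: "nat set" and H where Y: "finite Y" "card Y = card W" "hypergraph Y H"
    "\<forall>L \<in> closure_lines Y H. card L \<le> k" "m_bar (card W) k = card (closure_lines Y H)"
    using m_bar_attained[OF assms(2), of "card W"] by blast
  obtain f where "bij_betw f Y W"
    using finite_same_card_bij[OF Y(1) assms(1) Y(2)] by blast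
  then have f: "inj_on f Y" "f ` Y = W"
    by (auto simp: bij_betw_def)
  have H: "H \<subseteq> Pow Y"
    using Y(3) by (simp add: hypergraph_def)
  have lines: "closure_lines W ((`) f ` H) = (`) f ` closure_lines Y H"
    using closure_lines_image[OF f(1) H] f(2) by simp
  have sub: "L \<subseteq> Y" if "L \<in> closure_lines Y H" for L
    using closure_lines_subset[OF Y(3) that] .
  have inj: "inj_on ((`) f) (closure_lines Y H)"
    by (rule inj_on_subset[OF inj_on_image_Pow[OF f(1)]]) (use sub in blast)
  show ?thesis
  proof (rule that[of "(`) f ` H"])
    show "hypergraph W ((`) f ` H)"
      using H f(2) by (auto simp: hypergraph_def)
    show "card L \<le> k" if "L \<in> closure_lines W ((`) f ` H)" for L
      using that Y(4) sub f(1) unfolding lines by (auto simp: card_image inj_on_subset)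
    show "card (closure_lines W ((`) f ` H)) = m_bar (card W) k"
      using card_image[OF inj] Y(5) lines by simp
  qed
qed

section \<open>Two constructions: filling groups and blowing up points\<close>

text \<open>The edges are the blocks together with the edges of an optimal hypergraph inside each
  group. By injectivity of \<open>\<gamma>\<close> a block meets a group at most once, so the two
  kinds of edges do not interact: vertices of different groups generate their block, and vertices of
  one group generate the same line as inside the group.\<close>

lemma m_bar_grouping_le:
  assumes W: "finite W" "k \<ge> 2" and I: "finite I" "\<gamma> ` W \<subseteq> I"
    and B: "finite \<B>" "\<And>B. B \<in> \<B> \<Longrightarrow> B \<subseteq> W" "\<And>B. B \<in> \<B> \<Longrightarrow> card B \<le> k"
      "\<And>B. B \<in> \<B> \<Longrightarrow> inj_on \<gamma> B"
    and joined: "\<And>x y. x \<in> W \<Longrightarrow> y \<in> W \<Longrightarrow> \<gamma> x \<noteq> \<gamma> y \<Longrightarrow> \<exists>B\<in>\<B>. x \<in> B \<and> y \<in> B"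
    and unique: "\<And>B C x y. B \<in> \<B> \<Longrightarrow> C \<in> \<B> \<Longrightarrow> x \<noteq> y \<Longrightarrow> {x, y} \<subseteq> B \<inter> C \<Longrightarrow> B = C"
  shows "m_bar (card W) k \<le> card \<B> + (\<Sum>i\<in>I. m_bar (card {x\<in>W. \<gamma> x = i}) k)"
proof -
  define G where "G i = {x\<in>W. \<gamma> x = i}" for i
  have "\<exists>H. hypergraph (G i) H \<and> (\<forall>L\<in>closure_lines (G i) H. card L \<le> k) \<and>
      card (closure_lines (G i) H) = m_bar (card (G i)) k" for i
  proof -
    have "finite (G i)"
      using W(1) by (simp add: G_def)
    from m_bar_attained_on[OF this W(2)] show ?thesis
      by metis
  qed
  then obtain h where h: "\<And>i. hypergraph (G i) (h i)"
    "\<And>i L. L \<in> closure_lines (G i) (h i) \<Longrightarrow> card L \<le> k"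
    "\<And>i. card (closure_lines (G i) (h i)) = m_bar (card (G i)) k"
    by metis
  have hG: "E \<subseteq> G i" if "E \<in> h i" for E i
    using h(1) that unfolding hypergraph_def by blast
  define H where "H = \<B> \<union> (\<Union>i\<in>I. h i)"
  define \<L> where "\<L> = \<B> \<union> (\<Union>i\<in>I. closure_lines (G i) (h i))"
  have fin: "finite (closure_lines (G i) (h i))" for i
    by (rule finite_subset[of _ "Pow (G i)"])
      (use closure_lines_subset[OF h(1)] W(1) in \<open>auto simp: G_def\<close>)
  have "m_bar (card W) k \<le> card \<L>"
  proof (rule m_bar_le_family)
    show "finite W" by fact
    show "hypergraph W H"
      using B(2) hG by (force simp: hypergraph_def H_def G_def)
    show "finite \<L>"
      using fin I(1) B(1) by (simp add: \<L>_def)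
    show "card L \<le> k" if "L \<in> \<L>" for L
      using that B(3) h(2) by (auto simp: \<L>_def)
  next
    fix u v assume uv: "u \<in> W" "v \<in> W" "u \<noteq> v"
    show "\<exists>L\<in>\<L>. affinely_closed W H L \<and> u \<in> L \<and> v \<in> L \<and>
      (\<forall>T. affinely_closed W H T \<longrightarrow> u \<in> T \<longrightarrow> v \<in> T \<longrightarrow> L \<subseteq> T)"
    proof (cases "\<gamma> u = \<gamma> v")
      case False
      then obtain L where L: "L \<in> \<B>" "u \<in> L" "v \<in> L"
        using joined uv by blast
      have "affinely_closed W H L"
      proof (rule affinely_closedI)
        fix E x y
        assume E: "E \<in> H" "x \<noteq> y" "x \<in> E" "y \<in> E" "x \<in> L" "y \<in> L"
        \<comment> \<open>Two vertices of a block lie in different groups, so an edge sharing them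
          is again a block, and blocks sharing two vertices coincide.\<close>
        then have "\<gamma> x \<noteq> \<gamma> y"
          using B(4)[OF L(1)] by (auto simp: inj_on_def)
        then have "E \<in> \<B>"
          using E hG unfolding H_def G_def by blast
        then show "E \<subseteq> L"
          using unique[of E L x y] E L by blast
      qed (use B(2) L in blast)
      moreover have "L \<subseteq> T" if "affinely_closed W H T" "u \<in> T" "v \<in> T" for T
        using affinely_closedD[OF that(1) _ uv(3)] L that by (auto simp: H_def)
      ultimately show ?thesis
        using L by (intro bexI[of _ L]) (auto simp: \<L>_def)
    next
      case True
      define i where "i = \<gamma> u"
      define L where "L = aff (G i) (h i) {u, v}"
      have i: "i \<in> I" and uvG: "u \<in> G i" "v \<in> G i"
        using uv True I(2) by (auto simp: i_def G_def)
      have cl: "affinely_closed (G i) (h i) L"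
        unfolding L_def by (rule affinely_closed_aff) (use h(1) uvG in auto)
      then have LG: "L \<subseteq> G i"
        by (simp add: affinely_closed_def)
      have "affinely_closed W H L"
      proof (rule affinely_closedI)
        show "L \<subseteq> W"
          using LG by (auto simp: G_def)
        fix E x y
        assume E: "E \<in> H" "x \<noteq> y" "x \<in> E" "y \<in> E" "x \<in> L" "y \<in> L"
        then have xy: "\<gamma> x = i" "\<gamma> y = i"
          using LG by (auto simp: G_def)
        then have "E \<notin> \<B>"
          using E B(4) by (auto simp: inj_on_def)
        then obtain j where "j \<in> I" "E \<in> h j"
          using E unfolding H_def by blast
        then have "E \<in> h i"
          using hG[of E j] E xy by (auto simp: G_def)
        then show "E \<subseteq> L"
          using affinely_closedD[OF cl] E by blast
      qed
      moreover have "L \<subseteq> T" if T: "affinely_closed W H T" "u \<in> T" "v \<in> T" for T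
      proof -
        \<comment> \<open>The trace of a closed set on the group is closed there, hence contains the
          line \<open>L\<close> of the group.\<close>
        have "affinely_closed (G i) (h i) (T \<inter> G i)"
        proof (rule affinely_closedI)
          fix E x y
          assume E: "E \<in> h i" "x \<noteq> y" "x \<in> E" "y \<in> E" "x \<in> T \<inter> G i" "y \<in> T \<inter> G i"
          then have "E \<subseteq> T"
            using affinely_closedD[OF T(1), of E x y] i by (auto simp: H_def)
          then show "E \<subseteq> T \<inter> G i"
            using hG E by blast
        qed auto
        then show ?thesis
          unfolding L_def aff_def using T uvG by blast
      qed
      moreover have "u \<in> L" "v \<in> L"
        by (auto simp: L_def aff_def)
      moreover have "L \<in> \<L>"
        using i uvG uv(3) unfolding \<L>_def closure_lines_def L_def by blast
      ultimately show ?thesis by blast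
    qed
  qed
  also have "\<dots> \<le> card \<B> + (\<Sum>i\<in>I. card (closure_lines (G i) (h i)))"
    unfolding \<L>_def using card_UN_le[OF I(1), of "\<lambda>i. closure_lines (G i) (h i)"]
    by (intro order_trans[OF card_Un_le]) simp
  finally show ?thesis
    by (simp add: h(3) flip: G_def)
qed

text \<open>The map \<open>\<phi>\<close> collapses cells of vertices to the points of a linear
  space with blocks \<open>\<B>\<close>. A cell is an edge and meets a triple edge at most once, so
  two vertices of one cell generate the cell. Through the triples, two vertices of different cells
  generate everything above their block; reaching the rest of their own two cells takes a third
  point, whence the lower bound 3 on block sizes.\<close>

lemma m_bar_blow_up_le:
  assumes W: "finite W" "\<phi> ` W = V" "\<And>p. p \<in> V \<Longrightarrow> card {x\<in>W. \<phi> x = p} \<le> s"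
    and B: "finite \<B>" "\<And>B. B \<in> \<B> \<Longrightarrow> B \<subseteq> V" "\<And>B. B \<in> \<B> \<Longrightarrow> card B \<le> r"
      "\<And>B. B \<in> \<B> \<Longrightarrow> card B \<ge> 3"
    and joined: "\<And>p q. p \<in> V \<Longrightarrow> q \<in> V \<Longrightarrow> p \<noteq> q \<Longrightarrow> \<exists>B\<in>\<B>. p \<in> B \<and> q \<in> B"
    and unique: "\<And>B C p q. B \<in> \<B> \<Longrightarrow> C \<in> \<B> \<Longrightarrow> p \<noteq> q \<Longrightarrow> {p, q} \<subseteq> B \<inter> C \<Longrightarrow> B = C"
    and k: "r * s \<le> k" "s \<le> k"
  shows "m_bar (card W) k \<le> card V + card \<B>"
proof -
  \<comment> \<open>\<open>P\<close> pulls point sets back to vertices: \<open>P {p}\<close> is the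
    cell of \<open>p\<close>, \<open>P B\<close> the union of the cells over
    \<open>B\<close>.\<close>
  define P where "P S = {x\<in>W. \<phi> x \<in> S}" for S
  \<comment> \<open>Cardinality 3 of the images says that a triple comes from three different
    cells.\<close>
  define H where "H = (\<lambda>p. P {p}) ` V \<union>
    {{a, b, c} | a b c. {a, b, c} \<subseteq> W \<and> card {\<phi> a, \<phi> b, \<phi> c} = 3 \<and> (\<exists>B\<in>\<B>. {\<phi> a, \<phi> b, \<phi> c} \<subseteq> B)}"
  define \<L> where "\<L> = (\<lambda>p. P {p}) ` V \<union> P ` \<B>"
  have finV: "finite V"
    using W by auto
  have three: "card {x, y, z} = 3 \<longleftrightarrow> x \<noteq> y \<and> x \<noteq> z \<and> y \<noteq> z" for x y z :: 'b
    by (auto simp: card_insert_if)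
  have "m_bar (card W) k \<le> card \<L>"
  proof (rule m_bar_le_family)
    show "finite W" by fact
    show "hypergraph W H"
      by (auto simp: hypergraph_def H_def P_def)
    show "finite \<L>"
      using finV B(1) by (simp add: \<L>_def)
  next
    fix L assume "L \<in> \<L>"
    then consider p where "p \<in> V" "L = P {p}" | B where "B \<in> \<B>" "L = P B"
      unfolding \<L>_def by blast
    then show "card L \<le> k"
    proof cases
      case 1
      then show ?thesis
        using W(3)[of p] k(2) by (simp add: P_def)
    next
      case 2
      have "L = (\<Union>p\<in>B. P {p})"
        using 2 by (auto simp: P_def)
      also have "card \<dots> \<le> (\<Sum>p\<in>B. card (P {p}))"
        using finite_subset[OF B(2)[OF 2(1)] finV] by (rule card_UN_le)
      also have "\<dots> \<le> (\<Sum>p\<in>B. s)"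
        using B(2)[OF 2(1)] W(3) by (intro sum_mono) (auto simp: P_def)
      also have "\<dots> \<le> r * s"
        using B(3)[OF 2(1)] by simp
      finally show ?thesis
        using k(1) by linarith
    qed
  next
    fix u v assume uv: "u \<in> W" "v \<in> W" "u \<noteq> v"
    then have uvV: "\<phi> u \<in> V" "\<phi> v \<in> V"
      using W(2) by auto
    show "\<exists>L\<in>\<L>. affinely_closed W H L \<and> u \<in> L \<and> v \<in> L \<and>
      (\<forall>T. affinely_closed W H T \<longrightarrow> u \<in> T \<longrightarrow> v \<in> T \<longrightarrow> L \<subseteq> T)"
    proof (cases "\<phi> u = \<phi> v")
      case True
      have "affinely_closed W H (P {\<phi> u})"
        by (rule affinely_closedI) (auto simp: H_def P_def three)
      moreover have "P {\<phi> u} \<subseteq> T" if "affinely_closed W H T" "u \<in> T" "v \<in> T" for T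
      proof (rule affinely_closedD[OF that(1) _ uv(3)])
        show "P {\<phi> u} \<in> H"
          using uvV by (simp add: H_def)
      qed (use uv True that in \<open>auto simp: P_def\<close>)
      ultimately show ?thesis
        using uv uvV(1) True by (intro bexI[of _ "P {\<phi> u}"] conjI allI impI) (simp_all add: \<L>_def P_def)
    next
      case False
      then obtain B where B': "B \<in> \<B>" "\<phi> u \<in> B" "\<phi> v \<in> B"
        using joined uvV by blast
      have "affinely_closed W H (P B)"
      proof (rule affinely_closedI)
        fix E x y
        assume E: "E \<in> H" "x \<noteq> y" "x \<in> E" "y \<in> E" "x \<in> P B" "y \<in> P B"
        from E(1) have "(\<exists>p\<in>V. E = P {p}) \<or> (\<exists>a b c. E = {a, b, c} \<and> {a, b, c} \<subseteq> W \<and>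
            card {\<phi> a, \<phi> b, \<phi> c} = 3 \<and> (\<exists>C\<in>\<B>. {\<phi> a, \<phi> b, \<phi> c} \<subseteq> C))"
          by (simp only: H_def Un_iff image_iff mem_Collect_eq)
        then show "E \<subseteq> P B"
        proof (elim disjE bexE exE conjE)
          fix p assume "E = P {p}"
          then show ?thesis
            using E(3,5) by (auto simp: P_def)
        next
          fix a b c C
          assume 2: "E = {a, b, c}" "{a, b, c} \<subseteq> W" "card {\<phi> a, \<phi> b, \<phi> c} = 3"
            and C: "C \<in> \<B>" "{\<phi> a, \<phi> b, \<phi> c} \<subseteq> C"
          \<comment> \<open>Distinct vertices of a triple lie in different cells, so its block
            shares two points with \<open>B\<close> and must equal \<open>B\<close>.\<close>
          have "\<phi> x \<noteq> \<phi> y"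
            using E(2-4) 2(1,3) by (auto simp: three)
          moreover have "{\<phi> x, \<phi> y} \<subseteq> C \<inter> B"
            using E(3-6) 2(1) C(2) by (auto simp: P_def)
          ultimately have "C = B"
            using unique[OF C(1) B'(1)] by blast
          then show ?thesis
            using 2(1,2) C(2) by (auto simp: P_def)
        qed
      qed (auto simp: P_def)
      moreover have "P B \<subseteq> T" if T: "affinely_closed W H T" "u \<in> T" "v \<in> T" for T
      proof
        \<comment> \<open>A triple edge adds any vertex over \<open>B\<close> that lies outside the
          two cells already represented.\<close>
        have step: "w \<in> T" if "a \<in> T" "b \<in> T" "\<phi> a \<noteq> \<phi> b" "w \<in> P B" "a \<in> P B" "b \<in> P B"
          "\<phi> w \<noteq> \<phi> a" "\<phi> w \<noteq> \<phi> b" for a b w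
        proof -
          have "{a, b, w} \<in> H"
            unfolding H_def using that B'(1)
            by (intro UnI2 CollectI exI[of _ a] exI[of _ b] exI[of _ w]) (auto simp: P_def three)
          then show ?thesis
            using affinely_closedD[OF T(1), of "{a, b, w}" a b] that by auto
        qed
        have "\<exists>p\<in>B. p \<noteq> \<phi> u \<and> p \<noteq> \<phi> v"
        proof (rule ccontr)
          assume "\<not> ?thesis"
          then have "card B \<le> card {\<phi> u, \<phi> v}"
            by (intro card_mono) auto
          also have "\<dots> \<le> 2"
            by (simp add: card_insert_if)
          finally show False
            using B(4)[OF B'(1)] by simp
        qed
        then obtain c where c: "c \<in> P B" "\<phi> c \<noteq> \<phi> u" "\<phi> c \<noteq> \<phi> v"
          using B(2)[OF B'(1)] W(2) unfolding P_def by blast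
        have uvP: "u \<in> P B" "v \<in> P B"
          using uv B' by (auto simp: P_def)
        have "c \<in> T"
          using step[of u v c] T uvP c False by simp
        fix w assume w: "w \<in> P B"
        \<comment> \<open>Vertices outside the cells of u and v come from u and v; the cell of u
          comes from v and c, and the cell of v from u and c.\<close>
        consider "\<phi> w \<noteq> \<phi> u" "\<phi> w \<noteq> \<phi> v" | "\<phi> w = \<phi> u" | "\<phi> w = \<phi> v"
          by blast
        then show "w \<in> T"
        proof cases
          case 1
          then show ?thesis using step[of u v w] T uvP w False by simp
        next
          case 2
          then show ?thesis using step[of v c w] T uvP w False c \<open>c \<in> T\<close> by simp
        next
          case 3
          then show ?thesis using step[of u c w] T uvP w False c \<open>c \<in> T\<close> by simp
        qed
      qed
      ultimately show ?thesis
        using uv B' by (intro bexI[of _ "P B"] conjI allI impI) (simp_all add: \<L>_def P_def)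
    qed
  qed
  also have "\<dots> \<le> card V + card \<B>"
    unfolding \<L>_def by (intro order_trans[OF card_Un_le] add_mono card_image_le finV B(1))
  finally show ?thesis .
qed

section \<open>Elementary bounds\<close>

text \<open>With the full vertex set as the only edge, it is the only closed set containing two
  vertices.\<close>

lemma m_bar_le_one:
  assumes "n \<le> k"
  shows "m_bar n k \<le> 1"
proof -
  have "m_bar (card {..<n}) k \<le> card {{..<n}}"
    by (rule m_bar_le_family[where H = "{{..<n}}"])
      (use assms in \<open>auto simp: hypergraph_def affinely_closed_def\<close>)
  then show ?thesis by simp
qed

lemma card_ordered_pairs:
  assumes "finite W"
  shows "card {(u, v). u \<in> W \<and> v \<in> W \<and> u \<noteq> v} = card W * (card W - 1)"
proof -
  have "{(u, v). u \<in> W \<and> v \<in> W \<and> u \<noteq> v} = (SIGMA u:W. W - {u})"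
    by auto
  then show ?thesis
    using assms by (simp add: card_SigmaI)
qed

text \<open>Without edges every set of vertices is closed, so the lines are the pairs; the bound
  counts them in both orders.\<close>

lemma m_bar_le_pairs:
  assumes "k \<ge> 2"
  shows "m_bar n k \<le> n * (n - 1)"
proof -
  define D where "D = {(u, v). u \<in> {..<n} \<and> v \<in> {..<n} \<and> u \<noteq> v}"
  have fin: "finite D"
    by (rule finite_subset[of _ "{..<n} \<times> {..<n}"]) (auto simp: D_def)
  have "m_bar (card {..<n}) k \<le> card ((\<lambda>(u, v). {u, v}) ` D)"
  proof (rule m_bar_le_family[where H = "{}"])
    show "card L \<le> k" if "L \<in> (\<lambda>(u, v). {u, v}) ` D" for L
      using that assms by (auto simp: D_def)
  qed (use fin in \<open>auto simp: hypergraph_def affinely_closed_def D_def image_iff\<close>)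
  also have "\<dots> \<le> card D"
    using fin by (rule card_image_le)
  finally show ?thesis
    using card_ordered_pairs[of "{..<n}"] by (simp add: D_def)
qed

text \<open>Double counting: each ordered pair of distinct vertices lies in the line it generates,
  and a line with at most k vertices contains at most k(k - 1) such pairs. The product form stays
  within the natural numbers.\<close>

lemma pairs_le_m_bar:
  assumes "k \<ge> 2"
  shows "n * (n - 1) \<le> m_bar n k * (k * (k - 1))"
proof -
  obtain W :: "nat set" and H where W: "finite W" "card W = n" "hypergraph W H"
    "\<forall>L \<in> closure_lines W H. card L \<le> k" "m_bar n k = card (closure_lines W H)"
    using m_bar_attained[OF assms] by blast
  define D where "D A = {(u :: nat, v). u \<in> A \<and> v \<in> A \<and> u \<noteq> v}" for A
  have fin: "finite L" if "L \<in> closure_lines W H" for L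
    using closure_lines_subset[OF W(3) that] W(1) finite_subset by blast
  have finD: "finite (D A)" if "finite A" for A
    by (rule finite_subset[of _ "A \<times> A"]) (use that in \<open>auto simp: D_def\<close>)
  have finlines: "finite (closure_lines W H)"
    by (rule finite_subset[of _ "Pow W"]) (use closure_lines_subset[OF W(3)] W(1) in auto)
  have "n * (n - 1) = card (D W)"
    using card_ordered_pairs[OF W(1)] W(2) by (simp add: D_def)
  also have "\<dots> \<le> card (\<Union>L\<in>closure_lines W H. D L)"
  proof (rule card_mono)
    show "finite (\<Union>L\<in>closure_lines W H. D L)"
      using finlines fin finD by blast
    show "D W \<subseteq> (\<Union>L\<in>closure_lines W H. D L)"
    proof (clarsimp simp: D_def)
      fix u v assume uv: "u \<in> W" "v \<in> W" "u \<noteq> v"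
      then have "aff W H {u, v} \<in> closure_lines W H" "u \<in> aff W H {u, v}" "v \<in> aff W H {u, v}"
        by (auto simp: closure_lines_def aff_def)
      then show "\<exists>L\<in>closure_lines W H. u \<in> L \<and> v \<in> L"
        by blast
    qed
  qed
  also have "\<dots> \<le> (\<Sum>L\<in>closure_lines W H. card (D L))"
    using finlines by (rule card_UN_le)
  also have "\<dots> \<le> (\<Sum>L\<in>closure_lines W H. k * (k - 1))"
    using W(4) by (intro sum_mono) (auto simp: D_def card_ordered_pairs[OF fin] intro!: mult_le_mono)
  finally show ?thesis
    using W(5) by simp
qed

section \<open>Affine planes and transversal designs over a finite field\<close>

text \<open>Division by \<open>v\<close> is injective on a residue class. Vertices are spread over
  cells and groups by their residues, and this bounds the sizes of both.\<close>

lemma card_mod_class_le: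
  fixes n v :: nat
  assumes "v > 0"
  shows "card {x \<in> {..<n}. x mod v = j} \<le> n div v + 1"
proof -
  have "card {x \<in> {..<n}. x mod v = j} \<le> card {..n div v}"
  proof (rule card_inj_on_le)
    show "inj_on (\<lambda>x. x div v) {x \<in> {..<n}. x mod v = j}"
      by (rule inj_onI) (metis (mono_tags, lifting) mem_Collect_eq div_mult_mod_eq)
    show "(\<lambda>x. x div v) ` {x \<in> {..<n}. x mod v = j} \<subseteq> {..n div v}"
      by (auto intro: div_le_mono)
  qed simp
  then show ?thesis by simp
qed

text \<open>The slope is explicit so that closure of a subfield under the operations puts both
  coefficients into it.\<close>

lemma line_through_points:
  fixes x y z w :: "'a :: field"
  assumes "x \<noteq> z"
  defines "a \<equiv> (y - w) / (x - z)"
  shows "y = a * x + (y - a * x)" "w = a * z + (y - a * x)"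
proof -
  have "a * (x - z) = y - w"
    using assms by simp
  then show "w = a * z + (y - a * x)"
    by (simp add: algebra_simps)
qed simp

text \<open>Subtracting the equations gives (a - a')(x - z) = 0.\<close>

lemma line_unique:
  fixes a b a' b' x z :: "'a :: idom"
  assumes "x \<noteq> z" and eqs: "a * x + b = a' * x + b'" "a * z + b = a' * z + b'"
  shows "a = a'" "b = b'"
proof -
  have "(a - a') * (x - z) = (a * x + b) - (a * z + b) - ((a' * x + b') - (a' * z + b'))"
    by (simp add: algebra_simps)
  then show "a = a'"
    using assms by simp
  then show "b = b'"
    using eqs by simp
qed

text \<open>Blow-up of the plane over the field of order q: vertex x goes to point number x mod q^2,
  so a cell has at most n div q^2 + 1 vertices. The hypothesis m >= 2 gives lines with at least 3
  points, and q^2 <= n makes every cell non-empty.\<close>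

lemma m_bar_le_affine_plane:
  fixes n k m :: nat
  defines "q \<equiv> 2 ^ m"
  assumes "m \<ge> 2" and n: "q\<^sup>2 \<le> n" and k: "q * (n div q\<^sup>2 + 1) \<le> k"
  shows "m_bar n k \<le> 3 * q\<^sup>2"
proof -
  have "m > 0"
    using assms(2) by simp
  obtain F :: "bit alg_closure set" where F: "card F = 2 ^ m"
    and clos: "\<And>x y. x \<in> F \<Longrightarrow> y \<in> F \<Longrightarrow> x + y \<in> F \<and> x - y \<in> F \<and> x * y \<in> F \<and> x / y \<in> F"
    using finite_field_of_order_power_2[OF \<open>m > 0\<close>] by blast
  have cardF: "card F = q"
    using F by (simp add: q_def)
  have q: "q \<ge> 4"
    using power_increasing[of 2 m "2::nat"] assms(2) by (simp add: q_def)
  have finF: "finite F"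
    using cardF q by (intro card_ge_0_finite) simp
  define V where "V = F \<times> F"
  have cardV: "card V = q\<^sup>2"
    by (simp add: V_def card_cartesian_product cardF power2_eq_square)
  define line where "line a b = (\<lambda>x. (x, a * x + b)) ` F" for a b
  \<comment> \<open>The graphs of affine functions and the vertical lines.\<close>
  define \<B> where "\<B> = (\<lambda>(a, b). line a b) ` V \<union> (\<lambda>c. {c} \<times> F) ` F"
  have card_line: "card B = q" if "B \<in> \<B>" for B
    using that cardF by (auto simp: \<B>_def line_def card_cartesian_product inj_on_def card_image)
  obtain e where e: "bij_betw e {..<q\<^sup>2} V"
    using ex_bij_betw_nat_finite[of V] finF cardV by (auto simp: V_def atLeast0LessThan)
  define \<phi> where "\<phi> x = e (x mod q\<^sup>2)" for x
  have q2: "q\<^sup>2 > 0"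
    using q by simp
  have "m_bar (card {..<n}) k \<le> card V + card \<B>"
  proof (rule m_bar_blow_up_le[where \<phi> = \<phi> and r = q and s = "n div q\<^sup>2 + 1"])
    show "\<phi> ` {..<n} = V"
    proof
      show "\<phi> ` {..<n} \<subseteq> V"
        using bij_betwE[OF e] q2 by (auto simp: \<phi>_def)
      show "V \<subseteq> \<phi> ` {..<n}"
      proof
        fix p assume "p \<in> V"
        then obtain j where "j < q\<^sup>2" "p = e j"
          using e by (auto simp: bij_betw_def)
        then show "p \<in> \<phi> ` {..<n}"
          using n by (intro image_eqI[of _ _ j]) (auto simp: \<phi>_def)
      qed
    qed
    show "card {x \<in> {..<n}. \<phi> x = p} \<le> n div q\<^sup>2 + 1" if "p \<in> V" for p
    proof -
      obtain j where j: "j < q\<^sup>2" "p = e j"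
        using e \<open>p \<in> V\<close> by (auto simp: bij_betw_def)
      have "\<phi> x = p \<longleftrightarrow> x mod q\<^sup>2 = j" for x
        using bij_betw_imp_inj_on[OF e] j q2 by (auto simp: \<phi>_def inj_on_eq_iff)
      then show ?thesis
        using card_mod_class_le[OF q2] by simp
    qed
    show "finite \<B>"
      using finF by (simp add: \<B>_def V_def)
    show "B \<subseteq> V" if "B \<in> \<B>" for B
      using that clos by (auto simp: \<B>_def V_def line_def)
    show "card B \<le> q" "card B \<ge> 3" if "B \<in> \<B>" for B
      using card_line[OF that] q by auto
  next
    fix p r assume pr: "p \<in> V" "r \<in> V" "p \<noteq> r"
    obtain x y z w where xy: "p = (x, y)" "r = (z, w)"
      by fastforce
    show "\<exists>B\<in>\<B>. p \<in> B \<and> r \<in> B"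
    proof (cases "x = z")
      case True
      then show ?thesis
        using pr xy by (intro bexI[of _ "{x} \<times> F"]) (auto simp: \<B>_def V_def)
    next
      case False
      define a where "a = (y - w) / (x - z)"
      define b where "b = y - a * x"
      have "a \<in> F" "b \<in> F"
        using pr xy clos by (auto simp: a_def b_def V_def)
      moreover have "y = a * x + b" "w = a * z + b"
        unfolding a_def b_def by (rule line_through_points[OF False])+
      ultimately show ?thesis
        using pr xy by (intro bexI[of _ "line a b"]) (auto simp: \<B>_def V_def line_def)
    qed
  next
    fix B C p r assume BC: "B \<in> \<B>" "C \<in> \<B>" "p \<noteq> r" "{p, r} \<subseteq> B \<inter> C"
    show "B = C"
    proof (cases "fst p = fst r")
      case True
      have "K = {fst p} \<times> F" if "K \<in> \<B>" "p \<in> K" "r \<in> K" for K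
        using that True BC(3) by (auto simp: \<B>_def line_def)
      then show ?thesis
        using BC by blast
    next
      case False
      obtain a b where B: "B = line a b"
        using BC False by (auto simp: \<B>_def)
      obtain a' b' where C: "C = line a' b'"
        using BC False by (auto simp: \<B>_def)
      have eqs: "snd p = a * fst p + b" "snd r = a * fst r + b"
        "snd p = a' * fst p + b'" "snd r = a' * fst r + b'"
        using BC by (auto simp: B C line_def)
      then have "a = a'" "b = b'"
        using line_unique[OF False, of a b a' b'] by simp_all
      then show ?thesis
        by (simp add: B C)
    qed
  next
    show "n div q\<^sup>2 + 1 \<le> k"
      using order_trans[OF mult_le_mono1[of 1 q "n div q\<^sup>2 + 1"] k] q by simp
  qed (use k in auto)
  \<comment> \<open>There are q^2 points, at most q^2 lines with a slope and at most q vertical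
    ones.\<close>
  also have "\<dots> \<le> q\<^sup>2 + (q\<^sup>2 + q)"
    unfolding \<B>_def
    using card_image_le[of V "\<lambda>(a, b). line a b"] card_image_le[of F "\<lambda>c. {c} \<times> F"] finF cardV cardF
    by (intro add_mono order_trans[OF card_Un_le]) (auto simp: V_def)
  also have "\<dots> \<le> 3 * q\<^sup>2"
    using q by (simp add: power2_eq_square)
  finally show ?thesis by simp
qed

text \<open>Vertex x lies in group x mod g at level x div g. Since g <= q and n <= g q, groups and
  levels can both be labelled by field elements. The blocks are the graphs of affine functions from
  group labels to level labels, so two vertices of different groups lie in exactly one
  block.\<close>

lemma m_bar_le_transversal_design:
  fixes n k g m :: nat
  defines "q \<equiv> 2 ^ m"
  assumes "m > 0" "k \<ge> 2" and g: "0 < g" "g \<le> q" "g \<le> k" and n: "n \<le> g * q"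
  shows "m_bar n k \<le> q\<^sup>2 + (\<Sum>i<g. m_bar (card {x \<in> {..<n}. x mod g = i}) k)"
proof -
  obtain F :: "bit alg_closure set" where F: "card F = 2 ^ m"
    and clos: "\<And>x y. x \<in> F \<Longrightarrow> y \<in> F \<Longrightarrow> x + y \<in> F \<and> x - y \<in> F \<and> x * y \<in> F \<and> x / y \<in> F"
    using finite_field_of_order_power_2[OF \<open>m > 0\<close>] by blast
  have cardF: "card F = q"
    using F by (simp add: q_def)
  have finF: "finite F"
    using cardF g by (intro card_ge_0_finite) simp
  obtain e where e: "bij_betw e {..<q} F"
    using ex_bij_betw_nat_finite[OF finF] cardF by (auto simp: atLeast0LessThan)
  then have inj: "e i = e j \<longleftrightarrow> i = j" if "i < q" "j < q" for i j
    using that by (auto simp: bij_betw_def inj_on_eq_iff)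
  have eF: "e i \<in> F" if "i < q" for i
    using that bij_betwE[OF e] by simp
  have dm: "x div g < q" "x mod g < q" if "x < n" for x
  proof -
    show "x div g < q"
      using that n g(1) by (simp add: div_less_iff_less_mult mult.commute)
    show "x mod g < q"
      using g by (meson mod_less_divisor less_le_trans)
  qed
  \<comment> \<open>Each graph is cut down to the vertices that exist, since some combinations of
    group and level may be unoccupied.\<close>
  define block where "block a b = {x \<in> {..<n}. e (x div g) = a * e (x mod g) + b}" for a b
  define \<B> where "\<B> = (\<lambda>(a, b). block a b) ` (F \<times> F)"
  have inj_block: "inj_on (\<lambda>x. x mod g) B" if "B \<in> \<B>" for B
  proof (rule inj_onI)
    fix x y assume xy: "x \<in> B" "y \<in> B" "x mod g = y mod g"
    then have "e (x div g) = e (y div g)" "x < n" "y < n"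
      using that by (auto simp: \<B>_def block_def)
    then have "x div g = y div g"
      using inj dm by blast
    then show "x = y"
      using xy(3) by (metis div_mult_mod_eq)
  qed
  have "m_bar (card {..<n}) k \<le> card \<B> + (\<Sum>i\<in>{..<g}. m_bar (card {x \<in> {..<n}. x mod g = i}) k)"
  proof (rule m_bar_grouping_le)
    show "card B \<le> k" if "B \<in> \<B>" for B
    proof -
      have "card B \<le> card {..<g}"
        using g(1) by (intro card_inj_on_le[OF inj_block[OF that]]) auto
      then show ?thesis
        using g by simp
    qed
  next
    fix x y assume xy: "x \<in> {..<n}" "y \<in> {..<n}" "x mod g \<noteq> y mod g"
    define a where "a = (e (x div g) - e (y div g)) / (e (x mod g) - e (y mod g))"
    define b where "b = e (x div g) - a * e (x mod g)"
    have ne: "e (x mod g) \<noteq> e (y mod g)"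
      using xy inj dm by simp
    have "a \<in> F" "b \<in> F"
      using clos eF dm xy by (auto simp: a_def b_def)
    moreover have "e (x div g) = a * e (x mod g) + b" "e (y div g) = a * e (y mod g) + b"
      unfolding a_def b_def by (rule line_through_points[OF ne])+
    ultimately show "\<exists>B\<in>\<B>. x \<in> B \<and> y \<in> B"
      using xy by (intro bexI[of _ "block a b"]) (auto simp: \<B>_def block_def)
  next
    fix B C x y assume BC: "B \<in> \<B>" "C \<in> \<B>" "x \<noteq> y" "{x, y} \<subseteq> B \<inter> C"
    obtain a b where B: "B = block a b"
      using BC(1) by (auto simp: \<B>_def)
    obtain a' b' where C: "C = block a' b'"
      using BC(2) by (auto simp: \<B>_def)
    have "x mod g \<noteq> y mod g" and lt: "x < n" "y < n"
      using inj_block[OF BC(1)] BC(3,4) by (auto simp: inj_on_def B block_def)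
    then have ne: "e (x mod g) \<noteq> e (y mod g)"
      using inj dm by simp
    have eqs: "a * e (x mod g) + b = a' * e (x mod g) + b'" "a * e (y mod g) + b = a' * e (y mod g) + b'"
      using BC(4) by (auto simp: B C block_def)
    show "B = C"
      using line_unique[OF ne eqs] by (simp add: B C)
  qed (use g finF inj_block assms(3) in \<open>auto simp: \<B>_def block_def\<close>)
  moreover have "card \<B> \<le> q\<^sup>2"
    unfolding \<B>_def using card_image_le[of "F \<times> F" "\<lambda>(a, b). block a b"] finF
    by (simp add: card_cartesian_product cardF power2_eq_square)
  ultimately show ?thesis by simp
qed

section \<open>Choice of parameters and the recursion\<close>

text \<open>Take the least m with a <= b 2^m. Minimality gives b 2^(m-1) < a, and b < a rules out m
  = 0.\<close>

lemma power_2_sandwich: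
  fixes a b :: nat
  assumes "0 < b" "b < a"
  obtains m where "m > 0" "a \<le> b * 2 ^ m" "b * 2 ^ m < 2 * a"
proof -
  define m where "m = (LEAST m. a \<le> b * 2 ^ m)"
  have "a \<le> b * 2 ^ a"
    using assms less_exp[of a] by (metis less_imp_le le_trans mult_le_mono1 nat_mult_1 Suc_leI One_nat_def)
  then have m: "a \<le> b * 2 ^ m"
    unfolding m_def by (rule LeastI)
  then have "m > 0"
    using assms by (intro gr0I) auto
  moreover have "\<not> a \<le> b * 2 ^ (m - 1)"
    using \<open>m > 0\<close> unfolding m_def by (intro not_less_Least) simp
  moreover have "(2 :: nat) ^ m = 2 * 2 ^ (m - 1)"
    using \<open>m > 0\<close> by (metis power_eq_if not_gr0)
  ultimately show ?thesis
    using m that[of m] by simp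
qed

text \<open>The affine plane is used with 2n <= kq < 4n. The lower bound on q keeps the blown-up
  lines within k vertices; the upper bound, with 16n <= k^2, yields q^2 <= n and 4q <= k. The
  constant is 48 = 3 * 4^2, from 3 q^2 and q <= 4n/k.\<close>

lemma m_bar_le_of_small:
  fixes n k :: nat
  assumes "k < n" "16 * n \<le> k\<^sup>2"
  shows "real (m_bar n k) \<le> 48 * (real n / real k)\<^sup>2"
proof -
  have k0: "k > 0"
    using assms by (intro gr0I) auto
  then obtain m where m: "m > 0" "2 * n \<le> k * 2 ^ m" "k * 2 ^ m < 2 * (2 * n)"
    using power_2_sandwich[of k "2 * n"] assms by auto
  define q :: nat where "q = 2 ^ m"
  have q: "2 * n \<le> k * q" "k * q < 4 * n"
    using m by (auto simp: q_def)
  \<comment> \<open>For m = 1 the choice of m would say 2n <= 2k.\<close>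
  have "m \<noteq> 1"
    using m assms by auto
  then have "m \<ge> 2"
    using m(1) by simp
  \<comment> \<open>The chain is (kq)^2 <= 16 n^2 <= k^2 n, from which k^2 cancels.\<close>
  have "k\<^sup>2 * q\<^sup>2 \<le> (4 * n)\<^sup>2"
    using q(2) power_mono[of "k * q" "4 * n" 2] by (simp add: power_mult_distrib)
  also have "\<dots> = (16 * n) * n"
    by (simp add: power2_eq_square)
  also have "\<dots> \<le> k\<^sup>2 * n"
    using assms(2) by simp
  finally have q2n: "q\<^sup>2 \<le> n"
    using k0 by simp
  have "k * (4 * q) \<le> k * k"
    using q(2) assms(2) unfolding power2_eq_square by linarith
  then have "4 * q \<le> k"
    using k0 by simp
  have q0: "q > 0"
    by (simp add: q_def)
  \<comment> \<open>A blown-up line has at most q (n div q^2) + q vertices: the first summand is at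
    most n/q <= k/2, the second at most k/4.\<close>
  have "q * (n div q\<^sup>2) * q \<le> n"
    using times_div_less_eq_dividend[of "q\<^sup>2" n] by (simp add: power2_eq_square ac_simps)
  then have "2 * (q * (n div q\<^sup>2)) * q \<le> k * q"
    using q(1) by (metis mult.assoc mult_le_mono2 order_trans)
  then have "2 * (q * (n div q\<^sup>2)) \<le> k"
    using q0 by simp
  with \<open>4 * q \<le> k\<close> have "q * (n div q\<^sup>2 + 1) \<le> k"
    by (simp add: algebra_simps)
  then have "m_bar n k \<le> 3 * q\<^sup>2"
    using m_bar_le_affine_plane[OF \<open>m \<ge> 2\<close>] q2n by (simp add: q_def)
  then have "real (m_bar n k) \<le> 3 * (real q)\<^sup>2"
    by (metis of_nat_le_iff of_nat_mult of_nat_numeral of_nat_power)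
  also have "real q \<le> 4 * (real n / real k)"
  proof -
    have "real k * real q \<le> 4 * real n"
      using q(2) by (metis less_imp_le of_nat_le_iff of_nat_mult of_nat_numeral)
    then show ?thesis
      using k0 by (simp add: field_simps)
  qed
  then have "3 * (real q)\<^sup>2 \<le> 3 * (4 * (real n / real k))\<^sup>2"
    by (intro mult_left_mono power_mono) auto
  finally show ?thesis
    by (simp add: power2_eq_square)
qed

text \<open>Strong induction on n, measured against N = (n/k)^2. The summand 1 covers n <= k, where
  N may be small. For 16n > k^2 each of the g groups has at most 2n/g vertices, so by induction they
  contribute at most g + 800 N/g lines in total, which g >= 16 keeps well below 200 N.\<close>

lemma m_bar_upper_bound:
  fixes n k :: nat
  assumes k: "k \<ge> 64"
  shows "real (m_bar n k) \<le> 1 + 200 * (real n / real k)\<^sup>2"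
proof (induction n rule: less_induct)
  case (less n)
  define N where "N = (real n / real k)\<^sup>2"
  consider "n \<le> k" | "k < n" "16 * n \<le> k\<^sup>2" | "k < n" "k\<^sup>2 < 16 * n"
    by linarith
  then show ?case
  proof cases
    case 1
    then have "real (m_bar n k) \<le> 1"
      using m_bar_le_one by simp
    also have "\<dots> \<le> 1 + 200 * (real n / real k)\<^sup>2"
      by simp
    finally show ?thesis .
  next
    case 2
    then show ?thesis
      using m_bar_le_of_small[OF 2] by (smt (verit) zero_le_power2)
  next
    case 3
    \<comment> \<open>A quarter of k is large enough for k <= 5g, and small enough that k^2 < 16n
      forces g <= q.\<close>
    define g where "g = k div 4"
    have g: "g \<ge> 16" "4 * g \<le> k" "k \<le> 5 * g"
      using k by (auto simp: g_def)
    then obtain m where m: "m > 0" "n \<le> g * 2 ^ m" "g * 2 ^ m < 2 * n"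
      using power_2_sandwich[of g n] 3(1) by auto
    define q :: nat where "q = 2 ^ m"
    have q: "n \<le> g * q" "g * q < 2 * n"
      using m by (auto simp: q_def)
    have "16 * (g * g) \<le> k\<^sup>2"
      using mult_le_mono[OF g(2) g(2)] by (simp add: power2_eq_square)
    also have "\<dots> < 16 * n"
      by (rule 3)
    also have "\<dots> \<le> 16 * (g * q)"
      using q(1) by simp
    finally have "g \<le> q"
      by simp
    define s where "s i = card {x \<in> {..<n}. x mod g = i}" for i
    have s: "s i \<le> n div g + 1" for i
      unfolding s_def using g by (intro card_mod_class_le) simp
    have n: "g \<le> n" "n > 64"
      using 3(1) g(2) k by auto
    have "s i * g \<le> 2 * n" for i
    proof -
      have "s i * g \<le> (n div g + 1) * g"
        using s by (rule mult_le_mono1)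
      also have "\<dots> \<le> n + g"
        by simp
      finally show ?thesis
        using n by simp
    qed
    then have s': "real (s i) * real g \<le> 2 * real n" for i
      by (metis of_nat_le_iff of_nat_mult of_nat_numeral)
    \<comment> \<open>The groups are strictly smaller, by g >= 16 and n > 64, so the induction
      hypothesis applies to them.\<close>
    have s_less: "s i < n" for i
    proof -
      have "n div g \<le> n div 16"
        using g(1) by (intro div_le_mono2) auto
      then show ?thesis
        using s[of i] n(2) by linarith
    qed
    \<comment> \<open>The factor 2 in the group size is squared: 800 = 200 * 4.\<close>
    have IH: "real (m_bar (s i) k) \<le> 1 + 800 * N / (real g)\<^sup>2" for i
    proof -
      have "real (s i) / real k \<le> 2 * (real n / real k) / real g"
        using s'[of i] g k by (simp add: field_simps)
      then have "(real (s i) / real k)\<^sup>2 \<le> (2 * (real n / real k) / real g)\<^sup>2"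
        by (intro power_mono) auto
      also have "\<dots> = 4 * N / (real g)\<^sup>2"
        by (simp add: N_def power2_eq_square)
      finally show ?thesis
        using less.IH[OF s_less[of i]] by simp
    qed
    have "m_bar n k \<le> q\<^sup>2 + (\<Sum>i<g. m_bar (s i) k)"
      using m_bar_le_transversal_design[of m k g n] m(1,2) g \<open>g \<le> q\<close> k
      by (simp add: q_def s_def)
    then have "real (m_bar n k) \<le> real (q\<^sup>2 + (\<Sum>i<g. m_bar (s i) k))"
      by (rule of_nat_mono)
    also have "\<dots> = (real q)\<^sup>2 + (\<Sum>i<g. real (m_bar (s i) k))"
      by simp
    finally have "real (m_bar n k) \<le> (real q)\<^sup>2 + (\<Sum>i<g. real (m_bar (s i) k))" .
    also have "\<dots> \<le> (real q)\<^sup>2 + (\<Sum>i<g. 1 + 800 * N / (real g)\<^sup>2)"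
      by (intro add_left_mono sum_mono IH)
    also have "(\<Sum>i<g. 1 + 800 * N / (real g)\<^sup>2) = real g * (1 + 800 * N / (real g)\<^sup>2)"
      by simp
    also have "\<dots> = real g + 800 * N / real g"
      using g by (simp add: power2_eq_square distrib_left)
    finally have "real (m_bar n k) \<le> (real q)\<^sup>2 + (real g + 800 * N / real g)" .
    \<comment> \<open>From k^2 < 16n follows n/k >= k/16, so N >= k^2/256 >= k/4 >= g, where k >= 64
      enters.\<close>
    moreover have "real g \<le> N"
    proof -
      have "real k * real k \<le> 16 * real n"
        using 3(2) unfolding power2_eq_square by (metis less_imp_le of_nat_le_iff of_nat_mult of_nat_numeral)
      then have "real k / 16 \<le> real n / real k"
        using k by (simp add: field_simps)
      then have "(real k / 16)\<^sup>2 \<le> N"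
        unfolding N_def by (intro power_mono) auto
      moreover have "64 * real k \<le> real k * real k"
        using k by (intro mult_right_mono) auto
      moreover have "4 * real g \<le> real k"
        using g(2) by linarith
      ultimately show ?thesis
        by (simp add: power2_eq_square)
    qed
    moreover have "800 * N / real g \<le> 800 * N / 16"
      using g(1) by (intro divide_left_mono) (auto simp: N_def)
    \<comment> \<open>From gq < 2n and k <= 5g follows qk <= 10n.\<close>
    moreover have "(real q)\<^sup>2 \<le> 100 * N"
    proof -
      have "real (g * q) \<le> real (2 * n)"
        using q(2) by (intro of_nat_mono) simp
      then have gq: "real q * real g \<le> 2 * real n"
        by (simp add: mult.commute)
      have "real q * real k \<le> real q * (5 * real g)"
        using g(3) by (intro mult_left_mono) auto
      also have "\<dots> \<le> 10 * real n"
        using gq by linarith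
      finally have "real q \<le> 10 * (real n / real k)"
        using k by (simp add: field_simps)
      then have "(real q)\<^sup>2 \<le> (10 * (real n / real k))\<^sup>2"
        by (intro power_mono) auto
      then show ?thesis
        by (simp add: N_def power2_eq_square)
    qed
    \<comment> \<open>The blocks account for 100 N, the summand g for N, and the recursion for 50
      N.\<close>
    ultimately have "real (m_bar n k) \<le> 151 * N"
      by simp
    moreover have "N \<ge> 0"
      by (simp add: N_def)
    ultimately show ?thesis
      by (simp flip: N_def)
  qed
qed

section \<open>Combination of the lower and the upper bounds\<close>

theorem theorem9:
  shows "\<exists>c::real. c > 0 \<and> (\<forall>n k :: nat. n \<ge> k \<and> k \<ge> 2 \<longrightarrow>
     (real n * (real n - 1)) / (real k * (real k - 1)) \<le> real (m_bar n k) \<and>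
     real (m_bar n k) \<le> c * ((real n * (real n - 1)) / (real k * (real k - 1))))"
proof (intro exI[of _ "4096 :: real"] conjI allI impI)
  fix n k :: nat
  assume nk: "n \<ge> k \<and> k \<ge> 2"
  define R where "R = (real n * (real n - 1)) / (real k * (real k - 1))"
  have pairs: "real (j * (j - 1)) = real j * (real j - 1)" if "j \<ge> 2" for j :: nat
    using that by (simp add: of_nat_diff)
  have pos: "real k * (real k - 1) > 0"
    using nk by simp
  have "real (n * (n - 1)) \<le> real (m_bar n k * (k * (k - 1)))"
    using pairs_le_m_bar[of k n] nk by (simp only: of_nat_le_iff)
  then have "real n * (real n - 1) \<le> real (m_bar n k) * (real k * (real k - 1))"
    using nk pairs[of n] pairs[of k] by (simp only: of_nat_mult) simp
  then show "R \<le> real (m_bar n k)"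
    using pos by (simp add: R_def pos_divide_le_eq)
  show "real (m_bar n k) \<le> 4096 * R"
  proof (cases "k \<ge> 64")
    case True
    \<comment> \<open>As n >= k, passing from n/k to (n - 1)/(k - 1) does not decrease the ratio.
      Hence 1 <= (n/k)^2 <= R, and 1 + 200 (n/k)^2 <= 201 R.\<close>
    have "real n / real k \<le> (real n - 1) / (real k - 1)"
      using nk by (simp add: field_simps)
    then have "(real n / real k)\<^sup>2 \<le> real n / real k * ((real n - 1) / (real k - 1))"
      unfolding power2_eq_square by (intro mult_left_mono) auto
    also have "\<dots> = R"
      by (simp add: R_def)
    finally have "(real n / real k)\<^sup>2 \<le> R" .
    moreover have "1 \<le> (real n / real k)\<^sup>2"
      using nk by (simp add: field_simps)
    ultimately show ?thesis
      using m_bar_upper_bound[OF True, of n] by linarith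
  next
    case False
    \<comment> \<open>The constant 4096 = 64 * 64 comes from here: for k < 64 even the number n(n -
      1) of ordered pairs is at most 4096 R.\<close>
    have "real k * (real k - 1) \<le> 64 * 64"
      using False nk by (intro mult_mono) auto
    moreover have "R \<ge> 0"
      using nk by (simp add: R_def)
    ultimately have "real k * (real k - 1) * R \<le> 4096 * R"
      by (intro mult_right_mono) auto
    moreover have "real (m_bar n k) \<le> real n * (real n - 1)"
      using m_bar_le_pairs[of k n] nk pairs[of n] by (metis of_nat_le_iff le_trans)
    moreover have "real n * (real n - 1) = real k * (real k - 1) * R"
      unfolding R_def using pos by (metis nonzero_mult_div_cancel_left times_divide_eq_right less_irrefl)
    ultimately show ?thesis by linarith
  qed
qed simp

end
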